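(* Let $p$ and $q$ be integers such that either $p\geq 4$ and $q=2(p-2)(p-3)$, or $p\geq 5$ and $q=3(p-3)(p-4)/2$. Then the pineapple graph $K_p^q$ is not determined by its spectrum; that is, there exists a graph that is not isomorphic to $K_p^q$ but whose adjacency matrix has the same spectrum (eigenvalues with multiplicities) as that of $K_p^q$.
   Context: Graphs are finite, simple and undirected, and not assumed connected. For integers $p\geq 3$ and $q\geq 1$, the pineapple graph $K_p^q$ is the graph on $p+q$ vertices obtained from the complete graph $K_p$ by appending $q$ pendant edges to one vertex of $K_p$ (i.e. adding $q$ new vertices, each adjacent only to one fixed vertex of $K_p$, the same one for all new vertices). *)

theory Defs
  imports "Graph_Theory.Graph_Theory" "Jordan_Normal_Form.Char_Poly"
begin

text \<open>
  A finite simple undirected graph is a \<open>pair_graph\<close>: finite, loop-free, with a symmetric arc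
  relation, so that each edge is represented by its two opposite arcs. Isomorphism is
  \<open>digraph_iso\<close>.
\<close>

definition adj_matrix :: "'a::linorder pair_pre_digraph \<Rightarrow> complex mat" where
  "adj_matrix G = (let vs = sorted_list_of_set (pverts G); n = card (pverts G) in
     mat n n (\<lambda>(i, j). if (vs ! i, vs ! j) \<in> parcs G then 1 else 0))"

text \<open>
  Eigenvalues with multiplicities. The order on the vertices only fixes an indexing of the
  adjacency matrix; another indexing gives a similar matrix, hence the same spectrum.
\<close>

definition adj_spectrum :: "'a::linorder pair_pre_digraph \<Rightarrow> complex multiset" where
  "adj_spectrum G = proots (char_poly (adj_matrix G))"

text \<open>
  Every finite graph is isomorphic to one with vertices in \<open>nat\<close>, so letting \<open>H\<close> range over
  the latter loses nothing.
\<close>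

definition determined_by_spectrum :: "'a::linorder pair_pre_digraph \<Rightarrow> bool" where
  "determined_by_spectrum G \<longleftrightarrow>
     (\<forall>H :: nat pair_pre_digraph. pair_graph H \<and> adj_spectrum H = adj_spectrum G
        \<longrightarrow> digraph_iso (with_proj H) (with_proj G))"

text \<open>The vertices of \<open>K\<^sub>p\<close> are \<open>0, \<dots>, p - 1\<close>; the pendant edges are attached to \<open>0\<close>.\<close>

definition pineapple :: "nat \<Rightarrow> nat \<Rightarrow> nat pair_pre_digraph" where
  "pineapple p q = \<lparr>
     pverts = {0..<p + q},
     parcs = {(u, v). u < p \<and> v < p \<and> u \<noteq> v}
       \<union> {0} \<times> {p..<p + q} \<union> {p..<p + q} \<times> {0} \<rparr>"

lemma pair_graph_pineapple:
  assumes "p \<ge> 1"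
  shows "pair_graph (pineapple p q)"
proof -
  have "parcs (pineapple p q) \<subseteq> {0..<p + q} \<times> {0..<p + q}"
    using assms by (auto simp: pineapple_def)
  then have "finite (parcs (pineapple p q))"
    by (rule finite_subset) simp
  then show ?thesis
    using assms by unfold_locales (auto simp: pineapple_def symmetric_def sym_def)
qed

end

theory Submission
  imports Defs
begin

text \<open>
  The cospectral mate is the disjoint union of \<open>K\<close> on \<open>k + 1\<close> vertices, the join of \<open>K\<close> on
  \<open>u + 1\<close> vertices with \<open>s\<close> independent vertices, and isolated vertices. Both graphs are blowups of
  three cells into cliques or independent sets (up to isolated vertices), so the matrix determinant
  lemma reduces both characteristic polynomials to \<open>3 \<times> 3\<close> determinants. These agree if
  \<open>p = k + u + 2\<close>, \<open>q = (u + 1) r\<close>, \<open>s = k + 1 + r\<close> and \<open>r u = k (k + 1)\<close>; the values \<open>u = 1\<close> and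
  \<open>u = 2\<close> give the two families. The pineapple graph has a vertex adjacent to all others, its
  disconnected mate has none.
\<close>

section \<open>Determinant identities\<close>

text \<open>Both sides are the determinant of the block matrix \<open>?M\<close>: multiplying it
  from the left by \<open>?L\<close> or \<open>?K\<close>, both of determinant 1, clears one of its
  off-diagonal blocks. With \<open>m\<close> the number of cells this trades an
  \<open>n\<close>-dimensional determinant for a small one.\<close>

lemma det_one_minus_mult_commute:
  fixes P Q :: "'a :: idom mat"
  assumes P: "P \<in> carrier_mat n m" and Q: "Q \<in> carrier_mat m n"
  shows "det (1\<^sub>m n - P * Q) = det (1\<^sub>m m - Q * P)"
proof -
  let ?M = "four_block_mat (1\<^sub>m n) P Q (1\<^sub>m m)"
  let ?L = "four_block_mat (1\<^sub>m n) (- P) (0\<^sub>m m n) (1\<^sub>m m)"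
  let ?K = "four_block_mat (1\<^sub>m n) (0\<^sub>m n m) (- Q) (1\<^sub>m m)"
  have M: "?M \<in> carrier_mat (n + m) (n + m)" and L: "?L \<in> carrier_mat (n + m) (n + m)"
    and K: "?K \<in> carrier_mat (n + m) (n + m)"
    by auto
  have PQ: "1\<^sub>m n + - P * Q = 1\<^sub>m n - P * Q" and QP: "- Q * P + 1\<^sub>m m = 1\<^sub>m m - Q * P"
    using P Q by (auto intro!: eq_matI)
  have z: "- P + P = 0\<^sub>m n m" "- Q + Q = 0\<^sub>m m n"
    using P Q by (auto intro!: eq_matI)
  have LM: "?L * ?M = four_block_mat (1\<^sub>m n - P * Q) (0\<^sub>m n m) Q (1\<^sub>m m)"
    using P Q z
    by (subst mult_four_block_mat[where ?nr1.0 = n and ?n1.0 = n and ?n2.0 = m and ?nr2.0 = m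
          and ?nc1.0 = n and ?nc2.0 = m]) (auto simp: PQ comm_add_mat[of P])
  have KM: "?K * ?M = four_block_mat (1\<^sub>m n) P (0\<^sub>m m n) (1\<^sub>m m - Q * P)"
    using P Q z
    by (subst mult_four_block_mat[where ?nr1.0 = n and ?n1.0 = n and ?n2.0 = m and ?nr2.0 = m
          and ?nc1.0 = n and ?nc2.0 = m]) (auto simp: QP)
  have "det ?L = 1" using P by (subst det_four_block_mat_lower_left_zero[of _ n _ m]) auto
  then have "det ?M = det (?L * ?M)" by (simp add: det_mult[OF L M])
  also have "\<dots> = det (1\<^sub>m n - P * Q)"
    unfolding LM using P Q by (subst det_four_block_mat_upper_right_zero[of _ n _ m]) auto
  finally have 1: "det ?M = det (1\<^sub>m n - P * Q)" .
  have "det ?K = 1" using Q by (subst det_four_block_mat_upper_right_zero[of _ n _ m]) auto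
  then have "det ?M = det (?K * ?M)" by (simp add: det_mult[OF K M])
  also have "\<dots> = det (1\<^sub>m m - Q * P)"
    unfolding KM using P Q by (subst det_four_block_mat_lower_left_zero[of _ n _ m]) auto
  finally show ?thesis using 1 by simp
qed

lemma det_3x3:
  fixes A :: "'a :: comm_ring_1 mat"
  assumes "A \<in> carrier_mat 3 3"
  shows "det A =
    A $$ (0,0) * (A $$ (1,1) * A $$ (2,2) - A $$ (1,2) * A $$ (2,1))
    - A $$ (0,1) * (A $$ (1,0) * A $$ (2,2) - A $$ (1,2) * A $$ (2,0))
    + A $$ (0,2) * (A $$ (1,0) * A $$ (2,1) - A $$ (1,1) * A $$ (2,0))"
proof -
  have two: "det B = B $$ (0,0) * B $$ (1,1) - B $$ (0,1) * B $$ (1,0)"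
    if "B \<in> carrier_mat 2 2" for B :: "'a mat"
  proof -
    have del: "det (mat_delete B 0 j) = B $$ (1, if j = 0 then 1 else 0)" for j
    proof -
      have "mat_delete B 0 j \<in> carrier_mat 1 1"
        using that mat_delete_carrier[of B 2 2 0 j] by simp
      then have "det (mat_delete B 0 j) = mat_delete B 0 j $$ (0, 0)"
        by (rule det_single)
      then show ?thesis
        using that by (auto simp: mat_delete_def)
    qed
    have "det B = (\<Sum>j<2. B $$ (0, j) * cofactor B 0 j)"
      using that by (rule laplace_expansion_row) simp
    also have "\<dots> = (\<Sum>j\<in>{0, 1}. B $$ (0, j) * cofactor B 0 j)"
      by (intro sum.cong) auto
    finally show ?thesis
      by (simp add: cofactor_def del)
  qed
  have del: "det (mat_delete A 0 j) =
      A $$ (1, if j = 0 then 1 else 0) * A $$ (2, if j \<le> 1 then 2 else 1) -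
      A $$ (1, if j \<le> 1 then 2 else 1) * A $$ (2, if j = 0 then 1 else 0)" for j
  proof -
    have "mat_delete A 0 j \<in> carrier_mat 2 2"
      using assms mat_delete_carrier[of A 3 3 0 j] by simp
    from two[OF this] show ?thesis
      using assms by (auto simp: mat_delete_def numeral_2_eq_2)
  qed
  have "det A = (\<Sum>j<3. A $$ (0, j) * cofactor A 0 j)"
    using assms by (rule laplace_expansion_row) simp
  also have "\<dots> = (\<Sum>j\<in>{0, 1, 2}. A $$ (0, j) * cofactor A 0 j)"
    by (intro sum.cong) auto
  finally show ?thesis
    by (simp add: cofactor_def del right_diff_distrib)
qed

section \<open>Blowups and their characteristic polynomials\<close>

text \<open>The map \<open>c\<close> sorts vertices into cells. A cell related to itself becomes a
  clique, any other cell an independent set.\<close>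

definition blowup :: "nat \<Rightarrow> (nat \<Rightarrow> nat) \<Rightarrow> (nat \<Rightarrow> nat \<Rightarrow> bool) \<Rightarrow> nat pair_pre_digraph" where
  "blowup n c R = \<lparr> pverts = {0..<n},
     parcs = {(i, j). i < n \<and> j < n \<and> i \<noteq> j \<and> R (c i) (c j)} \<rparr>"

lemma pair_graph_blowup:
  assumes "symp R"
  shows "pair_graph (blowup n c R)"
proof -
  have "parcs (blowup n c R) \<subseteq> {0..<n} \<times> {0..<n}"
    by (auto simp: blowup_def)
  then have "finite (parcs (blowup n c R))"
    by (rule finite_subset) simp
  then show ?thesis
    using assms by unfold_locales (auto simp: blowup_def symmetric_def sym_def symp_def)
qed

lemma adj_matrix_blowup:
  "adj_matrix (blowup n c R) = mat n n (\<lambda>(i, j). of_bool (i \<noteq> j \<and> R (c i) (c j)))"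
  by (intro eq_matI) (auto simp: adj_matrix_def blowup_def Let_def)

text \<open>Up to a diagonal matrix, \<open>x I - A\<close> is the identity minus a product
  factoring through the \<open>m\<close> cells, so commuting the factors leaves a determinant
  indexed by cells. Cells from \<open>m\<close> on have no neighbours and enter only through the
  product.\<close>

lemma poly_char_poly_blowup:
  fixes x :: complex
  assumes R: "\<And>a b. R a b \<Longrightarrow> b < m"
    and x: "x \<noteq> 0" "x \<noteq> -1"
  shows "poly (char_poly (adj_matrix (blowup n c R))) x =
    (\<Prod>i<n. x + of_bool (R (c i) (c i))) *
    det (mat m m (\<lambda>(a, b). of_bool (a = b) -
      of_nat (card {i. i < n \<and> c i = a}) * of_bool (R a b) / (x + of_bool (R a a))))"
    (is "_ = _ * det ?S")
proof -
  define w where "w a = x + of_bool (R a a)" for a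
  have w: "w a \<noteq> 0" for a
    using x by (auto simp: w_def add_eq_0_iff2)
  define P where "P = mat n m (\<lambda>(i, b). of_bool (R (c i) b) / w (c i))"
  define Q where "Q = mat m n (\<lambda>(b, j). of_bool (c j = b) :: complex)"
  define W where "W = mat n n (\<lambda>(i, j). if i = j then w (c i) else 0)"
  let ?A = "adj_matrix (blowup n c R)"
  have A: "?A \<in> carrier_mat n n"
    by (simp add: adj_matrix_blowup)
  have P: "P \<in> carrier_mat n m" and Q: "Q \<in> carrier_mat m n" and W: "W \<in> carrier_mat n n"
    by (simp_all add: P_def Q_def W_def)
  have PQ: "(P * Q) $$ (i, j) = of_bool (R (c i) (c j)) / w (c i)" if "i < n" "j < n" for i j
  proof -
    have "(P * Q) $$ (i, j) = (\<Sum>b = 0..<m. of_bool (R (c i) b) / w (c i) * of_bool (c j = b))"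
      using that by (simp add: P_def Q_def scalar_prod_def)
    also have "\<dots> = (\<Sum>b = 0..<m. if b = c j then of_bool (R (c i) b) / w (c i) else 0)"
      by (intro sum.cong) auto
    also have "\<dots> = of_bool (R (c i) (c j)) / w (c i)"
      using R by auto
    finally show ?thesis .
  qed
  have QP: "(Q * P) $$ (a, b) =
      of_nat (card {i. i < n \<and> c i = a}) * of_bool (R a b) / w a" if "a < m" "b < m" for a b
  proof -
    have "(Q * P) $$ (a, b) = (\<Sum>i = 0..<n. of_bool (c i = a) * (of_bool (R (c i) b) / w (c i)))"
      using that by (simp add: P_def Q_def scalar_prod_def)
    also have "\<dots> = (\<Sum>i = 0..<n. if c i = a then of_bool (R a b) / w a else 0)"
      by (intro sum.cong) auto
    also have "\<dots> = (\<Sum>i \<in> {i. i < n \<and> c i = a}. of_bool (R a b) / w a)"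
      by (subst sum.inter_filter[symmetric]) (auto intro: sum.cong)
    finally show ?thesis by simp
  qed
  have WX: "(W * X) $$ (i, j) = w (c i) * X $$ (i, j)"
    if "X \<in> carrier_mat n n" "i < n" "j < n" for X i j
  proof -
    have "(W * X) $$ (i, j) = (\<Sum>l = 0..<n. (if i = l then w (c i) else 0) * X $$ (l, j))"
      using that by (simp add: W_def scalar_prod_def)
    also have "\<dots> = (\<Sum>l = 0..<n. if i = l then w (c i) * X $$ (l, j) else 0)"
      by (intro sum.cong) auto
    finally show ?thesis using that by simp
  qed
  have PQc: "1\<^sub>m n - P * Q \<in> carrier_mat n n"
    using P Q by auto
  \<comment> \<open>The product \<open>W * (P * Q)\<close> also has a 1 on the diagonal at each
    vertex of a self-related cell; the summand \<open>of_bool (R a a)\<close> in \<open>w\<close>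
    compensates for it.\<close>
  have "- char_matrix ?A x = W * (1\<^sub>m n - P * Q)"
  proof (rule eq_matI)
    fix i j assume "i < dim_row (W * (1\<^sub>m n - P * Q))" "j < dim_col (W * (1\<^sub>m n - P * Q))"
    then have ij: "i < n" "j < n" using W PQc P Q by auto
    then show "(- char_matrix ?A x) $$ (i, j) = (W * (1\<^sub>m n - P * Q)) $$ (i, j)"
      using P Q A w[of "c i"]
      by (subst WX[OF PQc])
        (auto simp: PQ char_matrix_def adj_matrix_blowup w_def right_diff_distrib simp del: index_mult_mat(1))
  qed (use A W P Q in \<open>auto simp: char_matrix_def\<close>)
  then have "poly (char_poly ?A) x = det W * det (1\<^sub>m n - P * Q)"
    by (simp add: char_poly_matrix[OF A] det_mult[OF W PQc])
  also have "det W = (\<Prod>i<n. w (c i))"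
    by (subst det_upper_triangular[OF _ W])
      (auto simp: W_def upper_triangular_def prod_list_diag_prod atLeast0LessThan)
  also have "1\<^sub>m m - Q * P = ?S"
    using P Q by (intro eq_matI) (auto simp: QP w_def simp del: index_mult_mat(1))
  then have "det (1\<^sub>m n - P * Q) = det ?S"
    using det_one_minus_mult_commute[OF P Q] by simp
  finally show ?thesis
    by (simp add: w_def)
qed

section \<open>An obstruction to isomorphism\<close>

lemma not_digraph_iso_if_dominating:
  fixes G H :: "nat pair_pre_digraph"
  assumes v: "v \<in> pverts G" "\<And>u. u \<in> pverts G \<Longrightarrow> u \<noteq> v \<Longrightarrow> (v, u) \<in> parcs G"
    and H: "\<And>v. v \<in> pverts H \<Longrightarrow> \<exists>u \<in> pverts H. u \<noteq> v \<and> (v, u) \<notin> parcs H"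
  shows "\<not> digraph_iso (with_proj H) (with_proj G)"
proof
  assume "digraph_iso (with_proj H) (with_proj G)"
  then obtain f where f: "pre_digraph.digraph_isomorphism (with_proj H) f"
    and G: "with_proj G = app_iso f (with_proj H)"
    unfolding digraph_iso_def by blast
  have verts: "pverts G = iso_verts f ` pverts H"
    using arg_cong[OF G, of verts] by simp
  have arcs: "parcs G = iso_arcs f ` parcs H"
    using arg_cong[OF G, of arcs] by simp
  \<comment> \<open>An isomorphism has separate maps for vertices, arcs, tails and heads. Since both
    graphs carry the projections, the arc map must act on endpoints as the vertex map does.\<close>
  have ends: "iso_tail f = fst" "iso_head f = snd"
    using arg_cong[OF G, of tail] arg_cong[OF G, of head] by simp_all
  have inj: "inj_on (iso_verts f) (pverts H)"
    and a: "\<And>a. a \<in> parcs H \<Longrightarrow>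
      iso_arcs f a = (iso_verts f (fst a), iso_verts f (snd a))"
    and wf: "wf_digraph (with_proj H)"
    using f ends by (auto simp: pre_digraph.digraph_isomorphism_def prod_eq_iff)
  obtain v' where v': "v' \<in> pverts H" "v = iso_verts f v'"
    using v(1) verts by auto
  obtain u where u: "u \<in> pverts H" "u \<noteq> v'" "(v', u) \<notin> parcs H"
    using H[OF v'(1)] by auto
  have "(v, iso_verts f u) \<in> parcs G"
    using u v' inj by (intro v(2)) (auto simp: verts dest: inj_onD)
  then obtain b where b: "b \<in> parcs H" "iso_verts f (fst b) = v" "iso_verts f (snd b) = iso_verts f u"
    using arcs a by auto
  have "fst b \<in> pverts H" "snd b \<in> pverts H"
    using wf_digraph.tail_in_verts[OF wf, of b] wf_digraph.head_in_verts[OF wf, of b] b(1) by simp_all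
  then have "b = (v', u)"
    using b v' u inj by (auto simp: prod_eq_iff dest: inj_onD)
  then show False
    using b(1) u(3) by simp
qed

section \<open>The pineapple graph and its mate as blowups\<close>

definition pineapple_cell :: "nat \<Rightarrow> nat \<Rightarrow> nat" where
  "pineapple_cell p i = (if i = 0 then 0 else if i < p then 1 else 2)"

text \<open>The pair \<open>(0,0)\<close> creates no arc, cell 0 being a singleton, but gives the
  centre the weight \<open>x + 1\<close> of the other clique vertices.\<close>

definition pineapple_rel :: "nat \<Rightarrow> nat \<Rightarrow> bool" where
  "pineapple_rel a b \<longleftrightarrow> (a, b) \<in> {(0,0), (0,1), (0,2), (1,0), (1,1), (2,0)}"

lemma pineapple_eq_blowup:
  assumes "p \<ge> 1"
  shows "pineapple p q = blowup (p + q) (pineapple_cell p) pineapple_rel"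
  using assms
  by (auto simp: pineapple_def blowup_def pineapple_cell_def pineapple_rel_def split: if_splits)

text \<open>Cell 3 holds the isolated vertices: it does not occur in
  \<open>mate_rel\<close>.\<close>

definition mate_cell :: "nat \<Rightarrow> nat \<Rightarrow> nat \<Rightarrow> nat \<Rightarrow> nat" where
  "mate_cell l p s i = (if i < l then 0 else if i < p then 1 else if i < p + s then 2 else 3)"

definition mate_rel :: "nat \<Rightarrow> nat \<Rightarrow> bool" where
  "mate_rel a b \<longleftrightarrow> (a, b) \<in> {(0,0), (1,1), (1,2), (2,1)}"

definition mate :: "nat \<Rightarrow> nat \<Rightarrow> nat \<Rightarrow> nat \<Rightarrow> nat pair_pre_digraph" where
  "mate l p q s = blowup (p + q) (mate_cell l p s) mate_rel"

lemma pair_graph_mate: "pair_graph (mate l p q s)"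
  unfolding mate_def by (rule pair_graph_blowup) (auto simp: symp_def mate_rel_def)

lemma not_iso_mate_pineapple:
  assumes "0 < l" "l < p"
  shows "\<not> digraph_iso (with_proj (mate l p q s)) (with_proj (pineapple p q))"
proof (rule not_digraph_iso_if_dominating[where v = 0])
  fix v assume v: "v \<in> pverts (mate l p q s)"
  show "\<exists>u\<in>pverts (mate l p q s). u \<noteq> v \<and> (v, u) \<notin> parcs (mate l p q s)"
    using assms v
    \<comment> \<open>The chosen non-neighbour lies on the other side of the cut at
      \<open>l\<close>, which no arc crosses.\<close>
    by (intro bexI[of _ "if v < l then l else 0"])
      (auto simp: mate_def blowup_def mate_cell_def mate_rel_def)
qed (use assms in \<open>auto simp: pineapple_def\<close>)

section \<open>Cospectrality\<close>

lemma char_poly_mate_eq_pineapple: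
  fixes k u r :: nat
  defines "p \<equiv> k + u + 2" and "q \<equiv> (u + 1) * r" and "s \<equiv> k + 1 + r"
  assumes kr: "r * u = k * (k + 1)" and k: "k \<ge> 1"
  shows "char_poly (adj_matrix (mate (k + 1) p q s)) = char_poly (adj_matrix (pineapple p q))"
    (is "?f = ?g")
proof -
  \<comment> \<open>The last summand counts the isolated vertices of the mate; in particular
    \<open>s \<le> q\<close>.\<close>
  have p: "p \<ge> 1" and n: "p + q = k + 1 + (u + 1) + s + (k + 1) * (k - 1)"
    using k kr by (cases k; simp add: p_def q_def s_def algebra_simps)+
  \<comment> \<open>The points \<open>0\<close> and \<open>-1\<close> are excluded because the reduction divides by \<open>x\<close> and \<open>x + 1\<close>.\<close>
  have "poly ?f x = poly ?g x" if x: "x \<noteq> 0" "x \<noteq> -1" for x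
  proof -
    let ?c = "mate_cell (k + 1) p s" and ?d = "pineapple_cell p"
    have "{i. i < p + q \<and> ?d i = 0} = {0}" "{i. i < p + q \<and> ?d i = 1} = {1..<p}"
        "{i. i < p + q \<and> ?d i = 2} = {p..<p + q}"
        "{i. i < p + q \<and> ?c i = 0} = {0..<k + 1}" "{i. i < p + q \<and> ?c i = 1} = {k + 1..<p}"
        "{i. i < p + q \<and> ?c i = 2} = {p..<p + s}"
      using p n by (auto simp: pineapple_cell_def mate_cell_def p_def split: if_splits)
    then have card: "card {i. i < p + q \<and> ?d i = 0} = 1" "card {i. i < p + q \<and> ?d i = 1} = k + u + 1"
        "card {i. i < p + q \<and> ?d i = 2} = q"
        "card {i. i < p + q \<and> ?c i = 0} = k + 1" "card {i. i < p + q \<and> ?c i = 1} = u + 1"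
        "card {i. i < p + q \<and> ?c i = 2} = s"
      by (simp_all add: p_def)
    \<comment> \<open>In both graphs the self-related cells cover exactly the vertices below
      \<open>p\<close>.\<close>
    have prod: "(\<Prod>i<p + q. x + of_bool (mate_rel (?c i) (?c i))) =
        (\<Prod>i<p + q. x + of_bool (pineapple_rel (?d i) (?d i)))"
      by (intro prod.cong)
        (auto simp: mate_rel_def pineapple_rel_def mate_cell_def pineapple_cell_def p_def)
    define K U V :: complex where KUV: "K = of_nat k" "U = of_nat u" "V = of_nat r"
    have rel: "V * U = K * (K + 1)"
      using arg_cong[OF kr, of "of_nat :: nat \<Rightarrow> complex"] by (simp add: KUV ring_distribs)
    define y where "y = inverse (x + 1)"
    define z where "z = inverse x"
    \<comment> \<open>Partial fractions for \<open>1 / (x (x + 1))\<close>.\<close>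
    have yz: "y * z = z - y"
      using x by (simp add: y_def z_def divide_simps add_eq_0_iff2)
    \<comment> \<open>These are the expanded determinants of the mate and of the pineapple graph;
      their difference is a combination of the relations \<open>yz\<close> and
      \<open>rel\<close>.\<close>
    let ?L = "(1 - (1 + K) * y) * (1 - (1 + U) * y - (1 + U) * (1 + (K + V)) * (y * z))"
    let ?R = "(1 - y) * (1 - (1 + (K + U)) * y) - (1 + (K + U)) * (y * y)
      - (1 - (1 + (K + U)) * y) * (V + U * V) * (y * z)"
    have "?L - ?R = (1 + K) * (1 + U) * y * (y * z - (z - y))
        + (1 + U) * y * (y * z) * (K * (K + 1) - V * U)"
      by (simp add: algebra_simps)
    then have key: "?L = ?R"
      by (simp add: yz rel)
    have eq: "det (mat 3 3 (\<lambda>(a, b). of_bool (a = b) -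
        of_nat (card {i. i < p + q \<and> ?c i = a}) * of_bool (mate_rel a b) /
          (x + of_bool (mate_rel a a)))) =
      det (mat 3 3 (\<lambda>(a, b). of_bool (a = b) -
        of_nat (card {i. i < p + q \<and> ?d i = a}) * of_bool (pineapple_rel a b) /
          (x + of_bool (pineapple_rel a a))))"
      using key
      by (simp add: det_3x3 mate_rel_def pineapple_rel_def card[simplified])
        (simp add: q_def s_def divide_inverse flip: KUV y_def z_def)
    have "mate_rel a b \<Longrightarrow> b < 3" "pineapple_rel a b \<Longrightarrow> b < 3" for a b
      by (auto simp: mate_rel_def pineapple_rel_def)
    note poly_char_poly_blowup[OF this(1) x] poly_char_poly_blowup[OF this(2) x]
    then show ?thesis
      unfolding mate_def pineapple_eq_blowup[OF p] by (simp only: prod eq)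
  qed
  \<comment> \<open>The extra factors vanish at the two excluded points, and as nonzero polynomials
    they cancel afterwards.\<close>
  then have "poly ((?f - ?g) * ([:0, 1:] * [:1, 1:])) x = poly 0 x" for x
    by (cases "x = 0 \<or> x = -1") auto
  then have "(?f - ?g) * ([:0, 1:] * [:1, 1:]) = 0"
    by (intro poly_eq_poly_eq_iff[THEN iffD1] ext)
  then show ?thesis
    unfolding mult_eq_0_iff by simp
qed

theorem mainTheorem3:
  fixes p q :: nat
  assumes "(p \<ge> 4 \<and> q = 2 * (p - 2) * (p - 3)) \<or> (p \<ge> 5 \<and> 2 * q = 3 * (p - 3) * (p - 4))"
  shows "\<not> determined_by_spectrum (pineapple p q)"
proof -
  have "\<exists>k u r. k \<ge> 1 \<and> r * u = k * (k + 1) \<and> p = k + u + 2 \<and> q = (u + 1) * r"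
    using assms
  proof (elim disjE conjE)
    assume "p \<ge> 4" "q = 2 * (p - 2) * (p - 3)"
    then show ?thesis
      \<comment> \<open>With \<open>u = 1\<close> the equations force \<open>k = p - 3\<close> and
        \<open>r = k (k + 1)\<close>.\<close>
      by (intro exI[of _ "p - 3"] exI[of _ 1] exI[of _ "(p - 2) * (p - 3)"])
        (auto simp: le_iff_add algebra_simps)
  next
    assume p: "p \<ge> 5" and q: "2 * q = 3 * (p - 3) * (p - 4)"
    \<comment> \<open>With \<open>u = 2\<close> they force \<open>k = p - 4\<close> and
      \<open>r = k (k + 1) / 2\<close>, an integer because \<open>k (k + 1)\<close> is even.\<close>
    define k where "k = p - 4"
    have "p = k + 4" using p by (simp add: k_def)
    moreover have "even (k * (k + 1))" by simp
    then obtain r where "k * (k + 1) = 2 * r" by blast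
    ultimately show ?thesis
      using p q by (intro exI[of _ k] exI[of _ 2] exI[of _ r]) (auto simp: algebra_simps)
  qed
  then obtain k u r where *: "r * u = k * (k + 1)" "k \<ge> 1"
    and pq: "p = k + u + 2" "q = (u + 1) * r"
    by blast
  let ?H = "mate (k + 1) p q (k + 1 + r)"
  have "adj_spectrum ?H = adj_spectrum (pineapple p q)"
    using char_poly_mate_eq_pineapple[OF *] by (simp add: adj_spectrum_def pq)
  moreover have "\<not> digraph_iso (with_proj ?H) (with_proj (pineapple p q))"
    by (rule not_iso_mate_pineapple) (auto simp: pq)
  ultimately show ?thesis
    unfolding determined_by_spectrum_def using pair_graph_mate by blast
qed

end
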